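(* Let $n$ be a positive integer, and let $X_n(\mu,\nu)=W_1(\mu,\nu)$ be the $1$-Wasserstein distance regarded as a random variable on the probability space $\Omega_n=\mathcal{P}_n\times\mathcal{P}_n$ equipped with the uniform (normalized Lebesgue) product probability measure. Then the first moment of $X_n$ is $$\mathbb{E}(X_n)=\frac{2^{2n-3}(n-1)}{(2n-1)!}\,\bigl((n-1)!\bigr)^2 .$$
   Context: Let $[n]=\{1,\dots,n\}$ with the metric $d(x,y)=|x-y|$. $\mathcal{P}_n$ denotes the set of all probability measures on $[n]$, identified with the standard simplex $\{(p_1,\dots,p_n)\in\mathbb{R}^n : p_i\ge 0,\ \sum_{i=1}^n p_i=1\}$. It carries the uniform probability measure, i.e. the $(n-1)$-dimensional Lebesgue measure on the simplex normalized to have total mass one. $\Omega_n=\mathcal{P}_n\times\mathcal{P}_n$ carries the product of these uniform probability measures, and $\mathbb{E}$ denotes expectation with respect to it. For $\mu,\nu\in\mathcal{P}_n$, the $1$-Wasserstein distance is $$W_1(\mu,\nu)=\inf_{\pi\in\Pi(\mu,\nu)}\int_{[n]\times[n]}|x-y|\,d\pi(x,y),$$ where $\Pi(\mu,\nu)$ is the set of probability measures on $[n]\times[n]$ with first marginal $\mu$ and second marginal $\nu$. Equivalently (a known fact), $W_1(\mu,\nu)=\sum_{i=1}^n|F_\mu(i)-F_\nu(i)|$, where $F_\mu(i)=\mu(\{1,\dots,i\})$ and $F_\nu(i)=\nu(\{1,\dots,i\})$ are the cumulative distribution functions. *)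

theory Defs
  imports "HOL-Probability.Probability"
begin

definition couplings :: "nat measure \<Rightarrow> nat measure \<Rightarrow> (nat \<times> nat) measure set" where
  "couplings \<mu> \<nu> = {\<pi>. prob_space \<pi> \<and> sets \<pi> = sets (\<mu> \<Otimes>\<^sub>M \<nu>)
     \<and> distr \<pi> \<mu> fst = \<mu> \<and> distr \<pi> \<nu> snd = \<nu>}"

(* For probability measures on {1..n} the cost is bounded and the product measure is a coupling,
   so the infimum is over a nonempty set of nonnegative reals. *)
definition wasserstein1 :: "nat measure \<Rightarrow> nat measure \<Rightarrow> real" where
  "wasserstein1 \<mu> \<nu> =
     (INF \<pi> \<in> couplings \<mu> \<nu>. LINT z|\<pi>. \<bar>real (fst z) - real (snd z)\<bar>)"

definition std_simplex :: "nat \<Rightarrow> (nat \<Rightarrow> real) set" where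
  "std_simplex n = {p \<in> {1..n} \<rightarrow>\<^sub>E UNIV. (\<forall>i\<in>{1..n}. 0 \<le> p i) \<and> (\<Sum>i\<in>{1..n}. p i) = 1}"

definition measure_of_weights :: "nat \<Rightarrow> (nat \<Rightarrow> real) \<Rightarrow> nat measure" where
  "measure_of_weights n p = point_measure {1..n} (\<lambda>i. ennreal (p i))"

(* The simplex lies in a hyperplane of R^n, so its (n-1)-dimensional Lebesgue measure is expressed
   in the affine chart given by the first n-1 coordinates. This is the surface measure up to a
   constant factor, which the normalization in uniform_simplex removes. For n = 1 the chart
   domain is a single point, of mass 1. *)
definition chart_domain :: "nat \<Rightarrow> (nat \<Rightarrow> real) set" where
  "chart_domain n =
     {x \<in> {1..<n} \<rightarrow>\<^sub>E UNIV. (\<forall>i\<in>{1..<n}. 0 \<le> x i) \<and> (\<Sum>i\<in>{1..<n}. x i) \<le> 1}"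

definition chart :: "nat \<Rightarrow> (nat \<Rightarrow> real) \<Rightarrow> nat \<Rightarrow> real" where
  "chart n x = (\<lambda>i\<in>{1..n}. if i < n then x i else 1 - (\<Sum>j\<in>{1..<n}. x j))"

definition simplex_lebesgue :: "nat \<Rightarrow> (nat \<Rightarrow> real) measure" where
  "simplex_lebesgue n =
     distr (restrict_space (Pi\<^sub>M {1..<n} (\<lambda>_. lborel)) (chart_domain n))
       (restrict_space (Pi\<^sub>M {1..n} (\<lambda>_. borel)) (std_simplex n)) (chart n)"

definition uniform_simplex :: "nat \<Rightarrow> (nat \<Rightarrow> real) measure" where
  "uniform_simplex n = uniform_measure (simplex_lebesgue n) (std_simplex n)"

definition Omega :: "nat \<Rightarrow> ((nat \<Rightarrow> real) \<times> (nat \<Rightarrow> real)) measure" where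
  "Omega n = uniform_simplex n \<Otimes>\<^sub>M uniform_simplex n"

definition X :: "nat \<Rightarrow> (nat \<Rightarrow> real) \<times> (nat \<Rightarrow> real) \<Rightarrow> real" where
  "X n \<omega> = wasserstein1 (measure_of_weights n (fst \<omega>)) (measure_of_weights n (snd \<omega>))"

end

theory Submission
  imports Defs
begin

text \<open>
  Write \<open>N = n - 1\<close>, and let \<open>F\<^sub>p i = p 1 + \<dots> + p i\<close> be the distribution function of the weights \<open>p\<close>.
  For a level \<open>u\<close> in \<open>(0, 1]\<close> let \<open>N\<^sub>p u\<close> be the number of \<open>i \<in> {1..<n}\<close> with \<open>F\<^sub>p i < u\<close>.
  As \<open>F\<^sub>p\<close> is monotone, these \<open>i\<close> form an initial segment, so \<open>N\<^sub>p u + 1\<close> is the \<open>u\<close>-quantile of \<open>p\<close>.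

  The quantiles of \<open>p\<close> and \<open>q\<close> at a common uniform level \<open>u\<close> are a coupling, and its cost
  is the integral of \<open>\<bar>N\<^sub>p u - N\<^sub>q u\<bar>\<close> over \<open>u\<close>, which equals the sum of the \<open>\<bar>F\<^sub>p i - F\<^sub>q i\<bar>\<close>. Every
  coupling costs at least that sum, because \<open>\<bar>x - y\<bar>\<close> counts the thresholds \<open>i\<close> that separate \<open>x\<close>
  from \<open>y\<close>. Hence the distance is the integral (lemma \<open>wasserstein1_eq_cdf_gap\<close>).

  The gain is that, at a fixed level \<open>u\<close>, \<open>N\<^sub>p u\<close> has a classical law when \<open>p\<close> is uniform on the
  simplex: the partial sums of \<open>p\<close> are distributed as \<open>N\<close> sorted independent uniform points, so
  \<open>N\<^sub>p u\<close> is binomial with parameters \<open>N\<close> and \<open>u\<close> (lemma \<open>nn_integral_count_below_uniform_simplex\<close>). It is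
  proved by integrating out one coordinate at a time. By Tonelli the expectation becomes the
  integral over \<open>u\<close> of the mean distance of two independent such binomial variables.

  That distance is the mean of \<open>\<bar>W\<^sub>N\<bar>\<close> for a symmetric lazy random walk \<open>W\<close> that moves up or down with
  probability \<open>u * (1 - u)\<close> each, and \<open>\<bar>W\<bar>\<close> grows on average only when the walk leaves \<open>0\<close>. So the mean
  is \<open>2 * u * (1 - u)\<close> times a sum of return probabilities, each of which is a sum of squared Bernstein
  polynomials (lemma \<open>mean_gap_Suc\<close>). The Beta integral turns these into
  factorials, the Vandermonde convolution with exponent \<open>- 3 / 2\<close> sums them, and the remaining
  sum over the steps telescopes (lemma \<open>has_integral_mean_gap\<close>).
\<close>

section \<open>The mean distance of two independent binomial variables\<close>

text \<open>
  These are the coefficients of \<open>(1 - 4 z) powr (- 3 / 2)\<close>. Squaring this series gives the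
  elementary \<open>(1 - 4 z) powr (- 3)\<close>, whence the closed form of their convolution below.
\<close>
lemma gbinomial_minus_three_halves:
  "((- 3 / 2 :: real) gchoose k) * (- 4) ^ k = fact (2 * k + 1) / (fact k)\<^sup>2"
proof (induction k)
  case (Suc k)
  have "real (Suc k) * ((- 3 / 2 :: real) gchoose Suc k) = (- 3 / 2 - real k) * ((- 3 / 2) gchoose k)"
    using gbinomial_mult_1[of "- 3 / 2 :: real" k] by (simp add: algebra_simps)
  hence h: "((- 3 / 2 :: real) gchoose Suc k) = (- 3 / 2 - real k) / real (Suc k) * ((- 3 / 2) gchoose k)"
    by (simp add: field_simps del: of_nat_Suc)
  hence "((- 3 / 2 :: real) gchoose Suc k) * (- 4) ^ Suc k
      = (4 * real k + 6) / real (Suc k) * (((- 3 / 2) gchoose k) * (- 4) ^ k)"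
    unfolding h by (simp add: field_simps del: of_nat_Suc)
  also have "\<dots> = fact (2 * Suc k + 1) / (fact (Suc k))\<^sup>2"
    unfolding Suc.IH by (simp add: divide_simps power2_eq_square) (simp add: algebra_simps)
  finally show ?case .
qed simp

lemma odd_factorial_convolution:
  "(\<Sum>k\<le>r. fact (2 * k + 1) / (fact k)\<^sup>2 * (fact (2 * (r - k) + 1) / (fact (r - k))\<^sup>2))
     = 4 ^ r * (real r + 1) * (real r + 2) / 2"
proof -
  have "((- 3 :: real) gchoose r) * (- 4) ^ r = 4 ^ r * (real r + 1) * (real r + 2) / 2"
  proof (induction r)
    case (Suc r)
    have "real (Suc r) * ((- 3 :: real) gchoose Suc r) = (- 3 - real r) * ((- 3) gchoose r)"
      using gbinomial_mult_1[of "- 3 :: real" r] by (simp add: algebra_simps)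
    hence h: "((- 3 :: real) gchoose Suc r) = (- 3 - real r) / real (Suc r) * ((- 3) gchoose r)"
      by (simp add: field_simps del: of_nat_Suc)
    hence "((- 3 :: real) gchoose Suc r) * (- 4) ^ Suc r
        = 4 * (real r + 3) / real (Suc r) * (((- 3) gchoose r) * (- 4) ^ r)"
      unfolding h by (simp add: field_simps del: of_nat_Suc)
    also have "\<dots> = 4 ^ Suc r * (real (Suc r) + 1) * (real (Suc r) + 2) / 2"
      unfolding Suc.IH by (simp add: divide_simps) (simp add: algebra_simps)
    finally show ?case .
  qed simp
  moreover have "((- 3 :: real) gchoose r) * (- 4) ^ r
     = (\<Sum>k\<le>r. ((- 3 / 2) gchoose k) * (- 4) ^ k * (((- 3 / 2) gchoose (r - k)) * (- 4) ^ (r - k)))"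
  proof -
    have "((- 3 :: real) gchoose r) * (- 4) ^ r
       = (\<Sum>k\<le>r. ((- 3 / 2) gchoose k) * ((- 3 / 2) gchoose (r - k)) * (- 4) ^ r)"
      using gbinomial_Vandermonde[of "- 3 / 2 :: real" "- 3 / 2" r, symmetric]
      by (simp add: sum_distrib_right atMost_atLeast0)
    also have "\<dots> = (\<Sum>k\<le>r. ((- 3 / 2) gchoose k) * (- 4) ^ k * (((- 3 / 2) gchoose (r - k)) * (- 4) ^ (r - k)))"
    proof (intro sum.cong refl)
      fix k assume "k \<in> {..r}"
      hence "(- 4 :: real) ^ r = (- 4) ^ k * (- 4) ^ (r - k)"
        by (simp add: power_add[symmetric])
      thus "((- 3 / 2) gchoose k) * ((- 3 / 2) gchoose (r - k)) * (- 4 :: real) ^ r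
        = ((- 3 / 2) gchoose k) * (- 4) ^ k * (((- 3 / 2) gchoose (r - k)) * (- 4) ^ (r - k))"
        by (simp only: mult_ac)
    qed
    finally show ?thesis .
  qed
  ultimately show ?thesis
    unfolding gbinomial_minus_three_halves by simp
qed

text \<open>
  The Beta integral is known with real exponents, where \<open>0 powr 0 = 0\<close> differs from \<open>0 ^ 0 = 1\<close>;
  the proof therefore passes through the open interval.
\<close>
lemma has_integral_power_mult_power:
  "((\<lambda>t. t ^ a * (1 - t) ^ b) has_integral fact a * fact b / fact (a + b + 1)) {0..1::real}"
proof -
  have "Beta (real (Suc a)) (real (Suc b)) = fact a * fact b / fact (a + b + 1)"
    using Gamma_fact[of "a + b + 1", where ?'a = real] Gamma_fact[of a, where ?'a = real]
      Gamma_fact[of b, where ?'a = real]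
    by (simp add: Beta_def add_ac)
  hence "((\<lambda>t. t powr real a * (1 - t) powr real b) has_integral
      fact a * fact b / fact (a + b + 1)) {0<..<1}"
    using has_integral_Beta_real[of "real (Suc a)" "real (Suc b)"]
    by (simp add: has_integral_Icc_iff_Ioo)
  hence "((\<lambda>t. t ^ a * (1 - t) ^ b) has_integral fact a * fact b / fact (a + b + 1)) {0<..<1::real}"
    by (subst has_integral_cong[where g = "\<lambda>t. t powr real a * (1 - t) powr real b"])
       (auto simp: powr_realpow)
  thus ?thesis
    by (simp add: has_integral_Icc_iff_Ioo)
qed

text \<open>
  The expectation of \<open>\<bar>S - S'\<bar>\<close> for independent binomial variables \<open>S\<close> and \<open>S'\<close> with parameters
  \<open>m\<close> and \<open>t\<close>, whose probabilities are the Bernstein polynomials.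
\<close>
definition mean_gap :: "nat \<Rightarrow> real \<Rightarrow> real" where
  "mean_gap m t = (\<Sum>k\<le>m. \<Sum>l\<le>m. Bernstein m k t * Bernstein m l t * \<bar>real k - real l\<bar>)"

lemma Bernstein_Suc:
  "Bernstein (Suc m) (Suc k) t = t * Bernstein m k t + (1 - t) * Bernstein m (Suc k) t"
proof (cases "Suc k \<le> m")
  case True
  hence "m - k = Suc (m - Suc k)" by simp
  thus ?thesis by (simp add: Bernstein_def algebra_simps)
qed (auto simp: Bernstein_def not_le less_Suc_eq_le algebra_simps binomial_eq_0)

lemma Bernstein_Suc_0: "Bernstein (Suc m) 0 t = (1 - t) * Bernstein m 0 t"
  by (simp add: Bernstein_def)

text \<open>
  A binomial variable with \<open>m + 1\<close> trials is one with \<open>m\<close> trials plus an independent trial.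
\<close>
lemma sum_Bernstein_Suc:
  "(\<Sum>k\<le>Suc m. Bernstein (Suc m) k t * f k)
     = (\<Sum>k\<le>m. Bernstein m k t * (t * f (Suc k) + (1 - t) * f k))"
proof -
  have "(\<Sum>k\<le>Suc m. Bernstein (Suc m) k t * f k) = (1 - t) * (Bernstein m 0 t * f 0)
     + (\<Sum>k\<le>m. (t * Bernstein m k t + (1 - t) * Bernstein m (Suc k) t) * f (Suc k))"
    unfolding sum.atMost_Suc_shift Bernstein_Suc Bernstein_Suc_0 by simp
  also have "\<dots> = t * (\<Sum>k\<le>m. Bernstein m k t * f (Suc k))
     + (1 - t) * (\<Sum>k\<le>Suc m. Bernstein m k t * f k)"
    unfolding sum.atMost_Suc_shift[of _ m]
    by (simp add: sum.distrib sum_subtractf sum_distrib_left algebra_simps)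
  also have "(\<Sum>k\<le>Suc m. Bernstein m k t * f k) = (\<Sum>k\<le>m. Bernstein m k t * f k)"
    by (simp add: Bernstein_def binomial_eq_0)
  finally show ?thesis
    by (simp add: sum.distrib sum_subtractf sum_distrib_left algebra_simps)
qed

text \<open>
  Adding a trial to both variables moves \<open>S - S'\<close> up or down by one with probability \<open>t * (1 - t)\<close>
  each. Since \<open>\<bar>d + 1\<bar> + \<bar>d - 1\<bar> = 2 * \<bar>d\<bar>\<close> unless \<open>d = 0\<close>, the mean of \<open>\<bar>S - S'\<bar>\<close> changes only
  through the event \<open>S = S'\<close>, whose probability is the sum of squares.
\<close>
lemma mean_gap_Suc:
  "mean_gap (Suc m) t = mean_gap m t + 2 * t * (1 - t) * (\<Sum>k\<le>m. (Bernstein m k t)\<^sup>2)"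
proof -
  \<comment> \<open>The mean of the distance after one more trial, started from the counts \<open>k\<close> and \<open>l\<close>.\<close>
  let ?g = "\<lambda>k l. (t\<^sup>2 + (1 - t)\<^sup>2) * \<bar>real k - real l\<bar>
        + t * (1 - t) * (\<bar>real (Suc k) - real l\<bar> + \<bar>real k - real (Suc l)\<bar>)"
  let ?S = "\<lambda>k. \<Sum>l\<le>m. Bernstein m l t * (t * \<bar>real k - real (Suc l)\<bar> + (1 - t) * \<bar>real k - real l\<bar>)"
  have "mean_gap (Suc m) t = (\<Sum>k\<le>Suc m. Bernstein (Suc m) k t *
      (\<Sum>l\<le>Suc m. Bernstein (Suc m) l t * \<bar>real k - real l\<bar>))"
    by (simp only: mean_gap_def sum_distrib_left mult.assoc)
  also have "\<dots> = (\<Sum>k\<le>Suc m. Bernstein (Suc m) k t * ?S k)"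
    by (intro sum.cong refl arg_cong2[where f = "(*)"] sum_Bernstein_Suc)
  also have "\<dots> = (\<Sum>k\<le>m. Bernstein m k t * (t * ?S (Suc k) + (1 - t) * ?S k))"
    by (rule sum_Bernstein_Suc)
  also have "\<dots> = (\<Sum>k\<le>m. \<Sum>l\<le>m. Bernstein m k t * Bernstein m l t * ?g k l)"
    unfolding sum_distrib_left sum.distrib[symmetric]
    by (intro sum.cong refl) (simp add: algebra_simps power2_eq_square)
  also have "?g = (\<lambda>k l. \<bar>real k - real l\<bar> + (if k = l then 2 * t * (1 - t) else 0))"
  proof (intro ext)
    fix k l :: nat
    consider "k = l" | "k < l" | "l < k" by linarith
    thus "?g k l = \<bar>real k - real l\<bar> + (if k = l then 2 * t * (1 - t) else 0)"
      by cases (simp_all add: algebra_simps power2_eq_square)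
  qed
  also have "(\<Sum>k\<le>m. \<Sum>l\<le>m. Bernstein m k t * Bernstein m l t *
        (\<bar>real k - real l\<bar> + (if k = l then 2 * t * (1 - t) else 0)))
      = mean_gap m t + (\<Sum>k\<le>m. \<Sum>l\<le>m. if k = l then Bernstein m k t * Bernstein m l t * (2 * t * (1 - t)) else 0)"
    unfolding mean_gap_def sum.distrib[symmetric]
    by (intro sum.cong refl) (simp add: algebra_simps)
  also have "(\<Sum>k\<le>m. \<Sum>l\<le>m. if k = l then Bernstein m k t * Bernstein m l t * (2 * t * (1 - t)) else 0)
      = 2 * t * (1 - t) * (\<Sum>k\<le>m. (Bernstein m k t)\<^sup>2)"
    by (simp add: sum_distrib_left power2_eq_square mult_ac)
  finally show ?thesis .
qed

text \<open>
  After the Beta integral, the factorials in the squared binomial coefficients cancel to the two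
  factors of the convolution above.
\<close>
lemma has_integral_mean_gap_increment:
  "((\<lambda>t. 2 * t * (1 - t) * (\<Sum>k\<le>r. (Bernstein r k t)\<^sup>2)) has_integral
      (fact r)\<^sup>2 * 4 ^ r * (real r + 1) * (real r + 2) / fact (2 * r + 3)) {0..1}"
proof -
  let ?c = "\<lambda>k. fact (2 * k + 1) / (fact k)\<^sup>2 :: real"
  have "((\<lambda>t. \<Sum>k\<le>r. 2 * (real (r choose k))\<^sup>2 * (t ^ (2 * k + 1) * (1 - t) ^ (2 * (r - k) + 1)))
      has_integral (\<Sum>k\<le>r. 2 * (real (r choose k))\<^sup>2 *
        (fact (2 * k + 1) * fact (2 * (r - k) + 1) / fact ((2 * k + 1) + (2 * (r - k) + 1) + 1)))) {0..1}"
    by (intro has_integral_sum has_integral_mult_right has_integral_power_mult_power) simp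
  also have "(\<lambda>t. \<Sum>k\<le>r. 2 * (real (r choose k))\<^sup>2 * (t ^ (2 * k + 1) * (1 - t) ^ (2 * (r - k) + 1)))
      = (\<lambda>t. 2 * t * (1 - t) * (\<Sum>k\<le>r. (Bernstein r k t)\<^sup>2))"
    unfolding sum_distrib_left
    by (intro ext sum.cong refl) (simp add: Bernstein_def power_mult_distrib power_mult[symmetric] mult_ac)
  also have "(\<Sum>k\<le>r. 2 * (real (r choose k))\<^sup>2 *
        (fact (2 * k + 1) * fact (2 * (r - k) + 1) / fact ((2 * k + 1) + (2 * (r - k) + 1) + 1)))
      = (\<Sum>k\<le>r. 2 * (fact r)\<^sup>2 / fact (2 * r + 3) * (?c k * ?c (r - k)))"
  proof (intro sum.cong refl)
    fix k assume "k \<in> {..r}"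
    hence k: "k \<le> r" by simp
    hence e: "(2 * k + 1) + (2 * (r - k) + 1) + 1 = 2 * r + 3" by simp
    show "2 * (real (r choose k))\<^sup>2 *
        (fact (2 * k + 1) * fact (2 * (r - k) + 1) / fact ((2 * k + 1) + (2 * (r - k) + 1) + 1))
      = 2 * (fact r)\<^sup>2 / fact (2 * r + 3) * (?c k * ?c (r - k))"
      unfolding e binomial_fact[OF k]
      by (simp add: power2_eq_square divide_simps del: fact_Suc)
  qed
  also have "\<dots> = (fact r)\<^sup>2 * 4 ^ r * (real r + 1) * (real r + 2) / fact (2 * r + 3)"
    unfolding sum_distrib_left[symmetric] odd_factorial_convolution by (simp del: fact_Suc)
  finally show ?thesis .
qed

text \<open>
  The closed form is an antidifference of the increments: up to the common factor
  \<open>4 ^ m * (fact m)\<^sup>2 * (m + 1) / fact (2 * m + 3)\<close>, the induction step is the identity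
  \<open>m * (2 * m + 3) + (m + 2) = 2 * (m + 1)\<^sup>2\<close>.
\<close>
lemma has_integral_mean_gap:
  "(mean_gap m has_integral 4 ^ m / 2 * real m * (fact m)\<^sup>2 / fact (2 * m + 1)) {0..1}"
proof (induction m)
  case 0
  show ?case by (simp add: mean_gap_def[abs_def])
next
  case (Suc m)
  have f1: "fact (2 * m + 3) = (2 * real m + 3) * (2 * real m + 2) * fact (2 * m + 1)"
    by (simp add: eval_nat_numeral algebra_simps)
  have f2: "fact (2 * Suc m + 1) = (fact (2 * m + 3) :: real)"
    by (simp add: eval_nat_numeral)
  have "4 ^ m / 2 * real m * (fact m)\<^sup>2 / fact (2 * m + 1)
      + (fact m)\<^sup>2 * 4 ^ m * (real m + 1) * (real m + 2) / fact (2 * m + 3)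
    = 4 ^ Suc m / 2 * real (Suc m) * (fact (Suc m))\<^sup>2 / fact (2 * Suc m + 1)"
  proof -
    define F :: real where "F = fact (2 * m + 1)"
    have [simp]: "F > 0" "2 * real m + 3 > 0" "2 * real m + 2 > 0"
      unfolding F_def by auto
    show ?thesis
      unfolding f2 f1 F_def[symmetric]
      by (simp add: divide_simps power2_eq_square) (simp add: algebra_simps)
  qed
  with has_integral_add[OF Suc.IH has_integral_mean_gap_increment[of m]]
  show ?case by (simp only: mean_gap_Suc[abs_def])
qed

section \<open>Counting partial sums over a corner simplex\<close>

text \<open>
  The starting index \<open>a\<close> is a parameter so that coordinates can be removed from the front.
\<close>
definition count_below :: "nat \<Rightarrow> nat \<Rightarrow> (nat \<Rightarrow> real) \<Rightarrow> real \<Rightarrow> nat" where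
  "count_below a n x t = card {i\<in>{a..<n}. sum x {a..i} < t}"

text \<open>
  The coordinates outside \<open>{a..<n}\<close> are left free, so that membership is insensitive to them;
  integrals are taken over the product space, where they carry no freedom.
\<close>
definition corner :: "nat \<Rightarrow> nat \<Rightarrow> real \<Rightarrow> (nat \<Rightarrow> real) set" where
  "corner a n s = {x. (\<forall>i\<in>{a..<n}. 0 \<le> x i) \<and> sum x {a..<n} \<le> s}"

lemma sum_fun_upd_first:
  fixes y :: real
  assumes "a \<le> i"
  shows "sum (x(a := y)) {a..i} = y + sum x {Suc a..i}"
  using assms by (simp add: sum.atLeast_Suc_atMost)

text \<open>
  Fixing the first coordinate at \<open>y\<close> shifts the level by \<open>y\<close> for the remaining coordinates. The first
  partial sum is \<open>y\<close> itself, hence the increment by one when \<open>y < t\<close>.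
\<close>
lemma count_below_peel_less:
  assumes "a < n" "y < t"
  shows "count_below a n (x(a := y)) t = Suc (count_below (Suc a) n x (t - y))"
proof -
  have "{i\<in>{a..<n}. sum (x(a := y)) {a..i} < t}
      = insert a {i\<in>{Suc a..<n}. sum x {Suc a..i} < t - y}"
    using assms by (auto simp: sum_fun_upd_first algebra_simps Suc_le_eq order_less_le
        fun_upd_same simp del: fun_upd_apply)
  thus ?thesis unfolding count_below_def by simp
qed

lemma count_below_peel_ge:
  assumes "\<And>i. i \<in> {Suc a..<n} \<Longrightarrow> 0 \<le> x i" "t \<le> y"
  shows "count_below a n (x(a := y)) t = 0"
proof -
  have "\<not> sum (x(a := y)) {a..i} < t" if "i \<in> {a..<n}" for i
  proof -
    have "0 \<le> sum x {Suc a..i}" using that by (intro sum_nonneg assms(1)) auto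
    thus ?thesis using that assms(2) by (simp add: sum_fun_upd_first del: fun_upd_apply)
  qed
  thus ?thesis unfolding count_below_def by (simp add: card_eq_0_iff)
qed

lemma corner_peel:
  assumes "a < n"
  shows "x(a := y) \<in> corner a n s \<longleftrightarrow> 0 \<le> y \<and> x \<in> corner (Suc a) n (s - y)"
proof -
  have "sum (x(a := y)) {a..<n} = y + sum x {Suc a..<n}"
    using assms by (simp add: sum.atLeast_Suc_lessThan)
  thus ?thesis
    using assms by (auto simp: corner_def algebra_simps)
qed

lemma corner_nonempty: "x \<in> corner a n s \<Longrightarrow> 0 \<le> s"
  unfolding corner_def by (smt (verit) mem_Collect_eq sum_nonneg)

lemma measurable_count_below:
  assumes "{a..<n} \<subseteq> I" "f \<in> borel_measurable M" "g \<in> M \<rightarrow>\<^sub>M Pi\<^sub>M I (\<lambda>_. borel)"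
  shows "(\<lambda>\<omega>. count_below a n (g \<omega>) (f \<omega>)) \<in> M \<rightarrow>\<^sub>M count_space UNIV"
proof -
  note [measurable] = assms(2,3)
  have "(\<lambda>\<omega>. sum (g \<omega>) {a..i}) \<in> borel_measurable M" if "i \<in> {a..<n}" for i
  proof (intro borel_measurable_sum)
    fix j assume "j \<in> {a..i}"
    hence "j \<in> I" using that assms(1) by auto
    show "(\<lambda>\<omega>. g \<omega> j) \<in> borel_measurable M"
      by (rule measurable_compose[OF assms(3) measurable_component_singleton[OF \<open>j \<in> I\<close>]])
  qed
  hence [measurable]: "Measurable.pred M (\<lambda>\<omega>. i \<in> {a..<n} \<and> sum (g \<omega>) {a..i} < f \<omega>)" for i
    by (cases "i \<in> {a..<n}") simp_all
  show ?thesis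
    unfolding count_below_def by measurable
qed

lemma borel_measurable_count_below:
  assumes "{a..<n} \<subseteq> I" "f \<in> borel_measurable M" "g \<in> M \<rightarrow>\<^sub>M Pi\<^sub>M I (\<lambda>_. borel)"
  shows "(\<lambda>\<omega>. real (count_below a n (g \<omega>) (f \<omega>))) \<in> borel_measurable M"
  by (rule measurable_compose[OF measurable_count_below[OF assms]]) simp

lemma corner_measurable [measurable]:
  "corner a n s \<inter> space (Pi\<^sub>M {a..<n} (\<lambda>_. lborel)) \<in> sets (Pi\<^sub>M {a..<n} (\<lambda>_. lborel))"
proof -
  have "Measurable.pred (Pi\<^sub>M {a..<n} (\<lambda>_. lborel)) (\<lambda>x. x \<in> corner a n s)"
    unfolding corner_def by measurable
  thus ?thesis by (simp add: pred_def Int_def conj_commute)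
qed

lemma nn_integral_power_affine:
  assumes "0 \<le> (s::real)"
  shows "(\<integral>\<^sup>+y. ennreal ((s - y) ^ k / fact k) * indicator {0..s} y \<partial>lborel) = ennreal (s ^ Suc k / fact (Suc k))"
proof -
  have "((\<lambda>y. - ((s - y) ^ Suc k / fact (Suc k))) has_real_derivative (s - y) ^ k / fact k) (at y)" for y
    by (rule derivative_eq_intros refl | simp add: divide_simps)+
  from nn_integral_FTC_Icc[OF _ this, of 0 s] assms show ?thesis by simp
qed

text \<open>
  The points of the corner simplex of size \<open>s\<close> with exactly \<open>k\<close> partial sums below \<open>t\<close> have the
  volume of a product of corner simplices, one of dimension \<open>k\<close> and size \<open>t\<close> and one of the
  remaining dimension and size \<open>s - t\<close>. The induction integrates over the first coordinate \<open>y\<close>: for \<open>y < t\<close>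
  it raises the dimension of the first factor, while for \<open>y > t\<close> the count is \<open>0\<close> and only a volume
  is left. The function \<open>f\<close> is arbitrary because the shift by one of the count must be
  absorbed, and because \<open>f = (\<lambda>_. 1)\<close> yields that volume.
\<close>
lemma nn_integral_count_below_corner:
  assumes "0 \<le> t" "t \<le> s" "a \<le> n"
  shows "(\<integral>\<^sup>+x. f (count_below a n x t) * indicator (corner a n s) x \<partial>Pi\<^sub>M {a..<n} (\<lambda>_. lborel))
    = (\<Sum>k\<le>n - a. ennreal (t ^ k / fact k * ((s - t) ^ (n - a - k) / fact (n - a - k))) * f k)"
  using assms
proof (induction "n - a" arbitrary: a t s f)
  case 0
  hence "a = n" by simp
  have [simp]: "count_below n n x t = 0" for x by (simp add: count_below_def)
  have [simp]: "x \<in> corner n n s" for x using 0 by (simp add: corner_def)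
  show ?case by (simp add: \<open>a = n\<close> PiM_empty nn_integral_count_space_finite)
next
  case (Suc m)
  interpret product_sigma_finite "\<lambda>_. lborel" by standard
  have an: "a < n" and m: "m = n - Suc a" "n - a = Suc m" using Suc.hyps(2) by auto
  have ins: "{a..<n} = insert a {Suc a..<n}" using an by auto
  let ?M = "Pi\<^sub>M {Suc a..<n} (\<lambda>_. lborel :: real measure)"
  have meas: "(\<lambda>x. f (count_below a n x t) * indicator (corner a n s) x)
      \<in> borel_measurable (Pi\<^sub>M {a..<n} (\<lambda>_. lborel))"
  proof -
    have "(\<lambda>x. count_below a n x t) \<in> Pi\<^sub>M {a..<n} (\<lambda>_. lborel) \<rightarrow>\<^sub>M count_space UNIV"
      by (rule measurable_count_below[where I = "{a..<n}"]) (simp_all cong: measurable_cong_sets)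
    moreover have "(\<lambda>x. indicator (corner a n s) x :: ennreal) \<in> borel_measurable (Pi\<^sub>M {a..<n} (\<lambda>_. lborel))"
      by (simp add: borel_measurable_indicator_iff corner_measurable)
    ultimately show ?thesis by measurable
  qed
  \<comment> \<open>At level \<open>0\<close> only the term \<open>k = 0\<close> of the induction hypothesis survives.\<close>
  have volume: "(\<integral>\<^sup>+x. indicator (corner (Suc a) n r) x \<partial>?M) = ennreal (r ^ m / fact m)" if "0 \<le> r" for r
  proof -
    have "(\<Sum>k\<le>m. ennreal (0 ^ k / fact k * (r ^ (m - k) / fact (m - k))))
       = (\<Sum>k\<in>{0::nat}. ennreal (0 ^ k / fact k * (r ^ (m - k) / fact (m - k))))"
      by (rule sum.mono_neutral_right) (auto simp: zero_power)
    thus ?thesis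
      using Suc.hyps(1)[of "Suc a" 0 r "\<lambda>_. 1"] an that m by simp
  qed
  have "(\<integral>\<^sup>+x. f (count_below a n x t) * indicator (corner a n s) x \<partial>Pi\<^sub>M {a..<n} (\<lambda>_. lborel))
     = (\<integral>\<^sup>+y. (\<integral>\<^sup>+x. f (count_below a n (x(a := y)) t) * indicator (corner a n s) (x(a := y)) \<partial>?M) \<partial>lborel)"
    using meas unfolding ins by (subst product_nn_integral_insert_rev) auto
  also have "\<dots> = (\<integral>\<^sup>+y.
      (\<Sum>k\<le>m. ennreal ((t - y) ^ k / fact k) * indicator {0..t} y * (ennreal ((s - t) ^ (m - k) / fact (m - k)) * f (Suc k)))
      + ennreal ((s - y) ^ m / fact m) * indicator {t..s} y * f 0 \<partial>lborel)"
  \<comment> \<open>At \<open>y = t\<close> both indicators on the right equal one, so this null point is left out.\<close>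
  proof (rule nn_integral_cong_AE, rule AE_mp[OF AE_lborel_singleton[of t]], rule AE_I2, rule impI)
    fix y assume "y \<noteq> t"
    then consider "y < 0" | "0 \<le> y" "y < t" | "t < y" "y \<le> s" | "t < y" "s < y" by linarith
    thus "(\<integral>\<^sup>+x. f (count_below a n (x(a := y)) t) * indicator (corner a n s) (x(a := y)) \<partial>?M)
      = (\<Sum>k\<le>m. ennreal ((t - y) ^ k / fact k) * indicator {0..t} y * (ennreal ((s - t) ^ (m - k) / fact (m - k)) * f (Suc k)))
      + ennreal ((s - y) ^ m / fact m) * indicator {t..s} y * f 0" (is "?L = ?R")
    proof cases
      case 1
      thus ?thesis using Suc.prems an by (simp add: indicator_def corner_peel)
    next
      case 2
      have "?L = (\<integral>\<^sup>+x. f (Suc (count_below (Suc a) n x (t - y))) * indicator (corner (Suc a) n (s - y)) x \<partial>?M)"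
        using 2 an by (intro nn_integral_cong) (simp add: count_below_peel_less indicator_def corner_peel)
      also have "\<dots> = (\<Sum>k\<le>m. ennreal ((t - y) ^ k / fact k * ((s - t) ^ (m - k) / fact (m - k))) * f (Suc k))"
        using Suc.hyps(1)[of "Suc a" "t - y" "s - y" "\<lambda>k. f (Suc k)"] 2 Suc.prems an m by simp
      also have "\<dots> = (\<Sum>k\<le>m. ennreal ((t - y) ^ k / fact k) * (ennreal ((s - t) ^ (m - k) / fact (m - k)) * f (Suc k)))"
        using 2 Suc.prems by (intro sum.cong refl, subst ennreal_mult) (auto simp: mult.assoc)
      finally show ?thesis using 2 by simp
    next
      case 3
      have "count_below a n (x(a := y)) t = 0" if "x \<in> corner (Suc a) n (s - y)" for x
        using that 3 by (intro count_below_peel_ge) (auto simp: corner_def)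
      hence "?L = (\<integral>\<^sup>+x. f 0 * indicator (corner (Suc a) n (s - y)) x \<partial>?M)"
        using 3 an Suc.prems
        by (intro nn_integral_cong) (simp add: indicator_def corner_peel)
      also have "\<dots> = f 0 * ennreal ((s - y) ^ m / fact m)"
        using 3 by (subst nn_integral_cmult) (simp_all add: volume borel_measurable_indicator_iff corner_measurable)
      finally show ?thesis using 3 by (simp add: mult.commute)
    next
      case 4
      hence "x \<notin> corner (Suc a) n (s - y)" for x
        using corner_nonempty[of x "Suc a" n "s - y"] by auto
      thus ?thesis using 4 Suc.prems an by (simp add: indicator_def corner_peel)
    qed
  qed
  also have "\<dots> = (\<Sum>k\<le>m. (\<integral>\<^sup>+y. ennreal ((t - y) ^ k / fact k) * indicator {0..t} y \<partial>lborel)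
        * (ennreal ((s - t) ^ (m - k) / fact (m - k)) * f (Suc k)))
      + (\<integral>\<^sup>+y. ennreal ((s - y) ^ m / fact m) * indicator {t..s} y \<partial>lborel) * f 0"
    by (subst nn_integral_add, simp, simp, subst nn_integral_sum, simp)
       (simp add: nn_integral_multc)
  also have "(\<integral>\<^sup>+y. ennreal ((s - y) ^ m / fact m) * indicator {t..s} y \<partial>lborel)
      = (\<integral>\<^sup>+y. ennreal ((s - t - y) ^ m / fact m) * indicator {0..s - t} y \<partial>lborel)"
    by (subst nn_integral_real_affine[where c = 1 and t = t])
       (auto intro!: nn_integral_cong simp: indicator_def algebra_simps)
  also have "\<dots> = ennreal ((s - t) ^ Suc m / fact (Suc m))"
    using Suc.prems by (intro nn_integral_power_affine) simp
  also have "(\<Sum>k\<le>m. (\<integral>\<^sup>+y. ennreal ((t - y) ^ k / fact k) * indicator {0..t} y \<partial>lborel)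
        * (ennreal ((s - t) ^ (m - k) / fact (m - k)) * f (Suc k)))
     = (\<Sum>k\<le>m. ennreal (t ^ Suc k / fact (Suc k) * ((s - t) ^ (m - k) / fact (m - k))) * f (Suc k))"
    using Suc.prems unfolding nn_integral_power_affine[OF Suc.prems(1)]
    by (intro sum.cong refl, subst ennreal_mult) (auto simp: mult.assoc simp del: power_Suc fact_Suc)
  also have "\<dots> + ennreal ((s - t) ^ Suc m / fact (Suc m)) * f 0
     = (\<Sum>k\<le>n - a. ennreal (t ^ k / fact k * ((s - t) ^ (n - a - k) / fact (n - a - k))) * f k)"
    unfolding m(2) sum.atMost_Suc_shift by (simp add: add.commute del: power_Suc fact_Suc)
  finally show ?case .
qed

section \<open>Wasserstein distance on a segment\<close>

lemma std_simplex_iff: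
  "p \<in> std_simplex n \<longleftrightarrow> p \<in> extensional {1..n} \<and> (\<forall>i\<in>{1..n}. 0 \<le> p i) \<and> sum p {1..n} = 1"
  by (auto simp: std_simplex_def PiE_def)

lemma count_below_le: "count_below 1 n p u \<le> n - 1"
proof -
  have "card {i \<in> {1..<n}. sum p {1..i} < u} \<le> card {1..<n}" by (rule card_mono) auto
  thus ?thesis by (simp add: count_below_def)
qed

lemma count_below_less: "n \<ge> 1 \<Longrightarrow> count_below 1 n p u < n"
  using count_below_le[of n p u] by linarith

lemma simplex_cdf_mono:
  assumes "p \<in> std_simplex n" "i \<le> j" "j \<le> n"
  shows "sum p {1..i} \<le> sum p {1..j}"
  using assms by (intro sum_mono2) (auto simp: std_simplex_iff)

lemma simplex_cdf_bounds:
  assumes "p \<in> std_simplex n" "i \<le> n"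
  shows "0 \<le> sum p {1..i}" "sum p {1..i} \<le> 1"
  using simplex_cdf_mono[OF assms(1), of 0 i] simplex_cdf_mono[OF assms(1), of i n] assms
  by (auto simp: std_simplex_iff)

text \<open>
  This is the Galois connection between the quantile and the distribution function. Both directions
  use that the indices with a small partial sum form an initial segment.
\<close>
lemma le_count_below_iff:
  assumes "p \<in> std_simplex n" "i \<in> {1..<n}"
  shows "i \<le> count_below 1 n p u \<longleftrightarrow> sum p {1..i} < u"
proof
  assume *: "sum p {1..i} < u"
  have "{1..i} \<subseteq> {j\<in>{1..<n}. sum p {1..j} < u}"
  proof
    fix j assume "j \<in> {1..i}"
    thus "j \<in> {j\<in>{1..<n}. sum p {1..j} < u}"
      using assms * simplex_cdf_mono[OF assms(1), of j i] by auto
  qed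
  hence "card {1..i} \<le> count_below 1 n p u"
    unfolding count_below_def by (rule card_mono[rotated]) simp
  thus "i \<le> count_below 1 n p u" by simp
next
  assume *: "i \<le> count_below 1 n p u"
  show "sum p {1..i} < u"
  proof (rule ccontr)
    assume "\<not> sum p {1..i} < u"
    hence "{j\<in>{1..<n}. sum p {1..j} < u} \<subseteq> {1..<i}"
    proof (intro subsetI)
      fix j assume j: "j \<in> {j\<in>{1..<n}. sum p {1..j} < u}"
      hence "\<not> i \<le> j"
        using \<open>\<not> sum p {1..i} < u\<close> simplex_cdf_mono[OF assms(1), of i j] by auto
      thus "j \<in> {1..<i}" using j by auto
    qed
    hence "count_below 1 n p u \<le> card {1..<i}"
      unfolding count_below_def by (rule card_mono[rotated]) simp
    thus False using * assms(2) by auto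
  qed
qed

text \<open>
  The distance of two points is the number of thresholds that separate them. This makes the cost of
  a coupling comparable with distribution functions.
\<close>
lemma abs_diff_eq_sum_thresholds:
  assumes "x \<in> {1..n}" "y \<in> {1..n}"
  shows "\<bar>real x - real y\<bar> = (\<Sum>i\<in>{1..<n}. \<bar>of_bool (x \<le> i) - of_bool (y \<le> i)\<bar>)"
proof -
  have *: "\<bar>real x - real y\<bar> = (\<Sum>i\<in>{1..<n}. \<bar>of_bool (x \<le> i) - of_bool (y \<le> i)\<bar>)"
    if "x \<in> {1..n}" "y \<in> {1..n}" "x \<le> y" for x y :: nat
  proof -
    have "(\<Sum>i\<in>{1..<n}. \<bar>of_bool (x \<le> i) - of_bool (y \<le> i)\<bar>) = (\<Sum>i\<in>{x..<y}. 1 :: real)"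
      using that by (intro sum.mono_neutral_cong_right) auto
    thus ?thesis using that by simp
  qed
  show ?thesis
    using *[of x y] *[of y x] assms by (cases "x \<le> y") (auto simp: abs_minus_commute)
qed

text \<open>
  The left end is excluded because every quantile at level \<open>0\<close> would be \<open>1\<close>, even where the weight of
  \<open>1\<close> vanishes; on \<open>(0, 1]\<close> the description of the quantiles has no exceptions.
\<close>
definition unit_interval :: "real measure" where
  "unit_interval = restrict_space lborel {0<..1}"

lemma space_unit_interval [simp]: "space unit_interval = {0<..1}"
  by (simp add: unit_interval_def space_restrict_space)

lemma prob_space_unit_interval: "prob_space unit_interval"
  unfolding unit_interval_def by (intro prob_space_restrict_space) simp_all

lemma emeasure_unit_interval_Ioc:
  assumes "0 \<le> a" "a \<le> b" "b \<le> 1"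
  shows "{a<..b} \<in> sets unit_interval" "emeasure unit_interval {a<..b} = ennreal (b - a)"
proof -
  have sub: "{a<..b} \<subseteq> {0<..1}" using assms by auto
  show "{a<..b} \<in> sets unit_interval"
    unfolding unit_interval_def using sub by (subst sets_restrict_space_iff) auto
  show "emeasure unit_interval {a<..b} = ennreal (b - a)"
    unfolding unit_interval_def using sub assms by (subst emeasure_restrict_space) auto
qed

lemma measurable_unit_interval [measurable]: "(\<lambda>u. u) \<in> borel_measurable unit_interval"
  unfolding unit_interval_def by (rule measurable_restrict_space1) simp

lemma measurable_count_below_unit_interval [measurable]:
  "count_below a n p \<in> unit_interval \<rightarrow>\<^sub>M count_space UNIV"
  by (rule measurable_count_below[where I = UNIV and g = "\<lambda>_. p"]) (auto simp: space_PiM)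

lemma space_measure_of_weights [simp]: "space (measure_of_weights n p) = {1..n}"
  and sets_measure_of_weights [simp]: "sets (measure_of_weights n p) = Pow {1..n}"
  by (simp_all add: measure_of_weights_def space_point_measure sets_point_measure)

lemma emeasure_measure_of_weights:
  assumes "p \<in> std_simplex n" "A \<subseteq> {1..n}"
  shows "emeasure (measure_of_weights n p) A = ennreal (sum p A)"
  using assms unfolding measure_of_weights_def
  by (subst emeasure_point_measure_finite) (auto simp: std_simplex_iff subset_iff intro!: sum_ennreal)

lemma measurable_quantile:
  assumes "n \<ge> 1"
  shows "(\<lambda>u. Suc (count_below 1 n p u)) \<in> unit_interval \<rightarrow>\<^sub>M measure_of_weights n q"
proof -
  have "(\<lambda>u. Suc (count_below 1 n p u)) \<in> unit_interval \<rightarrow>\<^sub>M count_space UNIV" by measurable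
  hence "(\<lambda>u. Suc (count_below 1 n p u)) \<in> unit_interval \<rightarrow>\<^sub>M count_space {1..n}"
    by (rule measurable_count_space_extend[rotated 2]) (use count_below_less[OF assms] in \<open>auto simp: Suc_le_eq\<close>)
  thus ?thesis
    by (subst measurable_cong_sets[where M' = unit_interval and N' = "count_space {1..n}"]) simp_all
qed

text \<open>
  The quantile equals \<open>k\<close> exactly on the levels between two consecutive values of the distribution
  function, an interval of length \<open>p k\<close>.
\<close>
lemma distr_quantile:
  assumes "p \<in> std_simplex n" "n \<ge> 1"
  shows "distr unit_interval (measure_of_weights n p) (\<lambda>u. Suc (count_below 1 n p u)) = measure_of_weights n p"
proof (rule measure_eqI_finite[where A = "{1..n}"])
  note meas = measurable_quantile[OF assms(2), of p p]
  fix k assume k: "k \<in> {1..n}"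
  have preimage: "Suc (count_below 1 n p u) = k \<longleftrightarrow> u \<in> {sum p {1..k - 1}<..sum p {1..k}}" if u: "u \<in> {0<..1}" for u
  proof -
    have "k - 1 \<le> count_below 1 n p u \<longleftrightarrow> sum p {1..k - 1} < u"
    proof (cases "k = 1")
      case False
      hence "k - 1 \<in> {1..<n}" using k by auto
      thus ?thesis by (rule le_count_below_iff[OF assms(1)])
    qed (use u in auto)
    moreover have "k \<le> count_below 1 n p u \<longleftrightarrow> sum p {1..k} < u"
    proof (cases "k = n")
      case True
      thus ?thesis using count_below_less[OF assms(2), of p u] assms(1) u by (auto simp: std_simplex_iff)
    next
      case False
      thus ?thesis using le_count_below_iff[OF assms(1), of k] k by auto
    qed
    ultimately show ?thesis using k by auto
  qed
  have b: "0 \<le> sum p {1..k - 1}" "sum p {1..k - 1} \<le> sum p {1..k}" "sum p {1..k} \<le> 1"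
    using k simplex_cdf_bounds[OF assms(1)] simplex_cdf_mono[OF assms(1), of "k - 1" k] by auto
  have "(\<lambda>u. Suc (count_below 1 n p u)) -` {k} \<inter> {0<..1} = {sum p {1..k - 1}<..sum p {1..k}} \<inter> {0<..1}"
    using preimage by blast
  also have "\<dots> = {sum p {1..k - 1}<..sum p {1..k}}"
    using b by (auto simp del: One_nat_def)
  finally have "(\<lambda>u. Suc (count_below 1 n p u)) -` {k} \<inter> {0<..1} = {sum p {1..k - 1}<..sum p {1..k}}" .
  hence "emeasure (distr unit_interval (measure_of_weights n p) (\<lambda>u. Suc (count_below 1 n p u))) {k}
      = ennreal (sum p {1..k} - sum p {1..k - 1})"
    using k emeasure_unit_interval_Ioc(2)[OF b] by (subst emeasure_distr[OF meas]) auto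
  also have "sum p {1..k} - sum p {1..k - 1} = p k"
    using k by (cases k) auto
  finally show "emeasure (distr unit_interval (measure_of_weights n p) (\<lambda>u. Suc (count_below 1 n p u))) {k}
      = emeasure (measure_of_weights n p) {k}"
    using k by (simp add: emeasure_measure_of_weights[OF assms(1)])
qed simp_all

definition cdf_gap :: "nat \<Rightarrow> (nat \<Rightarrow> real) \<Rightarrow> (nat \<Rightarrow> real) \<Rightarrow> real" where
  "cdf_gap n p q = (\<Sum>i\<in>{1..<n}. \<bar>sum p {1..i} - sum q {1..i}\<bar>)"

text \<open>
  By the threshold identity, the integrand is the sum over \<open>i\<close> of the indicators of the levels
  between the two values of the distribution functions at \<open>i\<close>.
\<close>
lemma nn_integral_count_below_diff:
  assumes "p \<in> std_simplex n" "q \<in> std_simplex n" "n \<ge> 1"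
  shows "(\<integral>\<^sup>+u. ennreal \<bar>real (count_below 1 n p u) - real (count_below 1 n q u)\<bar> \<partial>unit_interval) = ennreal (cdf_gap n p q)"
proof -
  let ?F = "\<lambda>i. sum p {1..i}" and ?G = "\<lambda>i. sum q {1..i}"
  let ?I = "\<lambda>i. {min (?F i) (?G i)<..max (?F i) (?G i)}"
  have I: "?I i \<in> sets unit_interval" "emeasure unit_interval (?I i) = ennreal \<bar>?F i - ?G i\<bar>"
    if "i \<in> {1..<n}" for i
  proof -
    have bounds: "0 \<le> min (?F i) (?G i)" "max (?F i) (?G i) \<le> 1"
      using simplex_cdf_bounds[OF assms(1), of i] simplex_cdf_bounds[OF assms(2), of i] that by auto
    have le: "min (?F i) (?G i) \<le> max (?F i) (?G i)" by simp
    have "max (?F i) (?G i) - min (?F i) (?G i) = \<bar>?F i - ?G i\<bar>" by linarith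
    thus "emeasure unit_interval (?I i) = ennreal \<bar>?F i - ?G i\<bar>"
      using emeasure_unit_interval_Ioc(2)[OF bounds(1) le bounds(2)] by (simp only:)
    show "?I i \<in> sets unit_interval"
      by (rule emeasure_unit_interval_Ioc(1)[OF bounds(1) le bounds(2)])
  qed
  have "\<bar>real (count_below 1 n p u) - real (count_below 1 n q u)\<bar> = (\<Sum>i\<in>{1..<n}. indicator (?I i) u)" for u
  proof -
    have "\<bar>real (count_below 1 n p u) - real (count_below 1 n q u)\<bar>
       = \<bar>real (Suc (count_below 1 n p u)) - real (Suc (count_below 1 n q u))\<bar>" by simp
    also have "\<dots> = (\<Sum>i\<in>{1..<n}. \<bar>of_bool (\<not> i \<le> count_below 1 n p u) - of_bool (\<not> i \<le> count_below 1 n q u)\<bar>)"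
      using count_below_less[OF assms(3), of p u] count_below_less[OF assms(3), of q u]
      by (subst abs_diff_eq_sum_thresholds[of _ n]) (auto simp: Suc_le_eq not_le)
    also have "\<dots> = (\<Sum>i\<in>{1..<n}. indicator (?I i) u)"
    proof (intro sum.cong refl)
      fix i assume "i \<in> {1..<n}"
      from le_count_below_iff[OF assms(1) this, of u] le_count_below_iff[OF assms(2) this, of u]
      show "\<bar>of_bool (\<not> i \<le> count_below 1 n p u) - of_bool (\<not> i \<le> count_below 1 n q u)\<bar> = (indicator (?I i) u :: real)"
        by (auto simp: indicator_def)
    qed
    finally show ?thesis .
  qed
  hence "(\<integral>\<^sup>+u. ennreal \<bar>real (count_below 1 n p u) - real (count_below 1 n q u)\<bar> \<partial>unit_interval)
     = (\<integral>\<^sup>+u. (\<Sum>i\<in>{1..<n}. indicator (?I i) u) \<partial>unit_interval)"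
    by (simp add: sum_ennreal[symmetric] ennreal_indicator)
  also have "\<dots> = (\<Sum>i\<in>{1..<n}. ennreal \<bar>?F i - ?G i\<bar>)"
    using I by (subst nn_integral_sum) (auto intro!: sum.cong)
  finally show ?thesis by (simp add: cdf_gap_def sum_ennreal)
qed

lemma measurable_coupling:
  assumes "\<pi> \<in> couplings (measure_of_weights n p) (measure_of_weights n q)"
  shows "fst \<in> \<pi> \<rightarrow>\<^sub>M measure_of_weights n p" "snd \<in> \<pi> \<rightarrow>\<^sub>M measure_of_weights n q"
    and "space \<pi> = {1..n} \<times> {1..n}"
proof -
  have s: "sets \<pi> = sets (measure_of_weights n p \<Otimes>\<^sub>M measure_of_weights n q)"
    using assms by (simp add: couplings_def)
  show "fst \<in> \<pi> \<rightarrow>\<^sub>M measure_of_weights n p" "snd \<in> \<pi> \<rightarrow>\<^sub>M measure_of_weights n q"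
    by (simp_all add: measurable_cong_sets[OF s refl])
  show "space \<pi> = {1..n} \<times> {1..n}"
    using sets_eq_imp_space_eq[OF s] by (simp add: space_pair_measure)
qed

lemma measurable_measure_of_weights: "f \<in> borel_measurable (measure_of_weights n p)"
  unfolding measure_of_weights_def by simp

text \<open>
  The integral of the threshold identity against the coupling, and the triangle inequality for each
  threshold, leave only the marginals.
\<close>
lemma cdf_gap_le_coupling_cost:
  assumes p: "p \<in> std_simplex n" and q: "q \<in> std_simplex n"
    and \<pi>: "\<pi> \<in> couplings (measure_of_weights n p) (measure_of_weights n q)"
  shows "cdf_gap n p q \<le> (LINT z|\<pi>. \<bar>real (fst z) - real (snd z)\<bar>)"
proof -
  interpret prob_space \<pi> using \<pi> by (simp add: couplings_def)
  note fs = measurable_coupling[OF \<pi>]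
  have meas: "(\<lambda>z. of_bool (fst z \<le> i) :: real) \<in> borel_measurable \<pi>"
    "(\<lambda>z. of_bool (snd z \<le> i) :: real) \<in> borel_measurable \<pi>" for i
    by (rule measurable_compose[OF fs(1) measurable_measure_of_weights]
          measurable_compose[OF fs(2) measurable_measure_of_weights])+
  have int: "integrable \<pi> (\<lambda>z. of_bool (fst z \<le> i) :: real)"
    "integrable \<pi> (\<lambda>z. of_bool (snd z \<le> i) :: real)" for i
    by (rule integrable_const_bound[where B = 1]; use meas in simp)+
  have cdf: "(LINT z|\<pi>. of_bool (fst z \<le> i)) = sum p {1..i}"
    "(LINT z|\<pi>. of_bool (snd z \<le> i)) = sum q {1..i}" if "i \<in> {1..<n}" for i
  proof -
    have "(LINT z|\<pi>. of_bool (fst z \<le> i)) = (LINT x|distr \<pi> (measure_of_weights n p) fst. of_bool (x \<le> i) :: real)"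
      by (rule integral_distr[symmetric, OF fs(1) measurable_measure_of_weights])
    also have "\<dots> = (LINT x|measure_of_weights n p. indicator {1..i} x)"
      using \<pi> by (intro Bochner_Integration.integral_cong) (auto simp: couplings_def indicator_def)
    also have "\<dots> = sum p {1..i}"
      using that p simplex_cdf_bounds(1)[OF p, of i] by (subst Bochner_Integration.integral_indicator)
        (auto simp: measure_def emeasure_measure_of_weights Int_absorb2)
    finally show "(LINT z|\<pi>. of_bool (fst z \<le> i)) = sum p {1..i}" .
    have "(LINT z|\<pi>. of_bool (snd z \<le> i)) = (LINT x|distr \<pi> (measure_of_weights n q) snd. of_bool (x \<le> i) :: real)"
      by (rule integral_distr[symmetric, OF fs(2) measurable_measure_of_weights])
    also have "\<dots> = (LINT x|measure_of_weights n q. indicator {1..i} x)"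
      using \<pi> by (intro Bochner_Integration.integral_cong) (auto simp: couplings_def indicator_def)
    also have "\<dots> = sum q {1..i}"
      using that q simplex_cdf_bounds(1)[OF q, of i] by (subst Bochner_Integration.integral_indicator)
        (auto simp: measure_def emeasure_measure_of_weights Int_absorb2)
    finally show "(LINT z|\<pi>. of_bool (snd z \<le> i)) = sum q {1..i}" .
  qed
  have "cdf_gap n p q = (\<Sum>i\<in>{1..<n}. \<bar>LINT z|\<pi>. of_bool (fst z \<le> i) - of_bool (snd z \<le> i)\<bar>)"
    unfolding cdf_gap_def using int by (intro sum.cong refl) (simp add: cdf)
  also have "\<dots> \<le> (\<Sum>i\<in>{1..<n}. LINT z|\<pi>. \<bar>of_bool (fst z \<le> i) - of_bool (snd z \<le> i)\<bar>)"
    by (intro sum_mono integral_abs_bound)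
  also have "\<dots> = (LINT z|\<pi>. (\<Sum>i\<in>{1..<n}. \<bar>of_bool (fst z \<le> i) - of_bool (snd z \<le> i)\<bar>))"
    using int by (subst Bochner_Integration.integral_sum) auto
  also have "\<dots> = (LINT z|\<pi>. \<bar>real (fst z) - real (snd z)\<bar>)"
    using fs(3) by (intro Bochner_Integration.integral_cong refl abs_diff_eq_sum_thresholds[symmetric]) auto
  finally show ?thesis .
qed

text \<open>
  The quantiles of both distributions at the same uniform level attain the lower bound.
\<close>
lemma monotone_coupling:
  assumes p: "p \<in> std_simplex n" and q: "q \<in> std_simplex n" and n: "n \<ge> 1"
  defines "\<pi> \<equiv> distr unit_interval (measure_of_weights n p \<Otimes>\<^sub>M measure_of_weights n q)
      (\<lambda>u. (Suc (count_below 1 n p u), Suc (count_below 1 n q u)))"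
  shows "\<pi> \<in> couplings (measure_of_weights n p) (measure_of_weights n q)"
    and "(LINT z|\<pi>. \<bar>real (fst z) - real (snd z)\<bar>) = cdf_gap n p q"
proof -
  interpret prob_space unit_interval by (rule prob_space_unit_interval)
  note [measurable] = measurable_quantile[OF n, of p p] measurable_quantile[OF n, of q q]
  have pair [measurable]: "(\<lambda>u. (Suc (count_below 1 n p u), Suc (count_below 1 n q u)))
      \<in> unit_interval \<rightarrow>\<^sub>M measure_of_weights n p \<Otimes>\<^sub>M measure_of_weights n q"
    by measurable
  have "distr \<pi> (measure_of_weights n p) fst = measure_of_weights n p"
    unfolding \<pi>_def using distr_quantile[OF p n] by (subst distr_distr[OF measurable_fst pair]) (simp add: comp_def)
  moreover have "distr \<pi> (measure_of_weights n q) snd = measure_of_weights n q"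
    unfolding \<pi>_def using distr_quantile[OF q n] by (subst distr_distr[OF measurable_snd pair]) (simp add: comp_def)
  moreover have "prob_space \<pi>" unfolding \<pi>_def by (rule prob_space_distr[OF pair])
  ultimately show "\<pi> \<in> couplings (measure_of_weights n p) (measure_of_weights n q)"
    by (simp add: couplings_def \<pi>_def)
  have cost: "(\<lambda>z. \<bar>real (fst z) - real (snd z)\<bar>)
      \<in> borel_measurable (measure_of_weights n p \<Otimes>\<^sub>M measure_of_weights n q)"
    using measurable_compose[OF measurable_fst measurable_measure_of_weights, of real]
      measurable_compose[OF measurable_snd measurable_measure_of_weights, of real] by measurable
  have "(LINT z|\<pi>. \<bar>real (fst z) - real (snd z)\<bar>)
      = (LINT u|unit_interval. \<bar>real (count_below 1 n p u) - real (count_below 1 n q u)\<bar>)"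
    unfolding \<pi>_def by (subst integral_distr[OF pair cost]) simp
  also have "\<dots> = enn2real (ennreal (cdf_gap n p q))"
    unfolding nn_integral_count_below_diff[OF p q n, symmetric]
  proof (rule integral_eq_nn_integral)
    have "(\<lambda>u. real (count_below 1 n r u)) \<in> borel_measurable unit_interval" for r
      by (rule measurable_compose[OF measurable_count_below_unit_interval]) simp
    thus "(\<lambda>u. \<bar>real (count_below 1 n p u) - real (count_below 1 n q u)\<bar>) \<in> borel_measurable unit_interval"
      by (intro borel_measurable_abs borel_measurable_diff)
  qed simp
  also have "\<dots> = cdf_gap n p q"
    by (simp add: cdf_gap_def sum_nonneg)
  finally show "(LINT z|\<pi>. \<bar>real (fst z) - real (snd z)\<bar>) = cdf_gap n p q" .
qed

lemma wasserstein1_eq_cdf_gap: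
  assumes "p \<in> std_simplex n" "q \<in> std_simplex n" "n \<ge> 1"
  shows "wasserstein1 (measure_of_weights n p) (measure_of_weights n q) = cdf_gap n p q"
  unfolding wasserstein1_def
  using monotone_coupling[OF assms] cdf_gap_le_coupling_cost[OF assms(1,2)]
  by (intro cInf_eq_minimum) (auto intro: rev_image_eqI)

section \<open>Uniform weights and binomial counts\<close>

text \<open>
  The chart keeps the first \<open>n - 1\<close> coordinates, hence all partial sums that are counted, so the
  integrals over the simplex reduce to those over the corner simplex of size \<open>1\<close>.
\<close>
lemma chart_domain_eq_corner:
  "chart_domain n = corner 1 n 1 \<inter> space (Pi\<^sub>M {1..<n} (\<lambda>_. lborel))"
  by (auto simp: chart_domain_def corner_def space_PiM)

lemma sum_chart: "i < n \<Longrightarrow> sum (chart n x) {1..i} = sum x {1..i}"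
  by (intro sum.cong) (auto simp: chart_def)

lemma count_below_chart: "count_below 1 n (chart n x) u = count_below 1 n x u"
  unfolding count_below_def by (rule arg_cong[where f = card]) (auto simp: sum_chart simp del: One_nat_def)

lemma chart_in_std_simplex:
  assumes "x \<in> chart_domain n" "n \<ge> 1"
  shows "chart n x \<in> std_simplex n"
proof -
  have split: "{1..n} = insert n {1..<n}" using assms(2) by auto
  have "(\<Sum>j\<in>{1..<n}. chart n x j) = (\<Sum>j\<in>{1..<n}. x j)"
    by (intro sum.cong) (auto simp: chart_def)
  moreover have "chart n x n = 1 - (\<Sum>j\<in>{1..<n}. x j)" using assms(2) by (simp add: chart_def)
  ultimately have "sum (chart n x) {1..n} = 1" unfolding split by simp
  thus ?thesis
    using assms by (auto simp: std_simplex_iff chart_domain_def chart_def)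
qed

lemma measurable_chart:
  assumes "n \<ge> 1"
  shows "chart n \<in> restrict_space (Pi\<^sub>M {1..<n} (\<lambda>_. lborel)) (chart_domain n)
    \<rightarrow>\<^sub>M restrict_space (Pi\<^sub>M {1..n} (\<lambda>_. borel)) (std_simplex n)"
proof (rule measurable_restrict_space3)
  show "chart n \<in> Pi\<^sub>M {1..<n} (\<lambda>_. lborel) \<rightarrow>\<^sub>M Pi\<^sub>M {1..n} (\<lambda>_. borel)"
    unfolding chart_def
  proof (rule measurable_restrict)
    fix i assume i: "i \<in> {1..n}"
    show "(\<lambda>x. if i < n then x i else 1 - (\<Sum>j\<in>{1..<n}. x j)) \<in> borel_measurable (Pi\<^sub>M {1..<n} (\<lambda>_. lborel))"
      using i by (cases "i < n") simp_all
  qed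
  show "chart n \<in> chart_domain n \<rightarrow> std_simplex n"
    using chart_in_std_simplex[OF _ assms] by auto
qed

lemma sets_uniform_simplex:
  "sets (uniform_simplex n) = sets (restrict_space (Pi\<^sub>M {1..n} (\<lambda>_. borel)) (std_simplex n))"
  by (simp add: uniform_simplex_def simplex_lebesgue_def)

lemma space_uniform_simplex: "space (uniform_simplex n) = std_simplex n"
  using sets_eq_imp_space_eq[OF sets_uniform_simplex[of n]]
  by (auto simp: space_restrict_space space_PiM std_simplex_def)

lemma measurable_uniform_simplex [measurable]:
  "(\<lambda>p. p) \<in> uniform_simplex n \<rightarrow>\<^sub>M Pi\<^sub>M {1..n} (\<lambda>_. borel)"
  by (subst measurable_cong_sets[OF sets_uniform_simplex refl])
     (rule measurable_restrict_space1[OF measurable_ident_sets[OF refl]])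

lemma nn_integral_simplex_lebesgue:
  assumes "n \<ge> 1" "f \<in> borel_measurable (uniform_simplex n)"
  shows "(\<integral>\<^sup>+p. f p \<partial>simplex_lebesgue n)
     = (\<integral>\<^sup>+x. f (chart n x) * indicator (corner 1 n 1) x \<partial>Pi\<^sub>M {1..<n} (\<lambda>_. lborel))"
proof -
  have "f \<in> borel_measurable (restrict_space (Pi\<^sub>M {1..n} (\<lambda>_. borel)) (std_simplex n))"
    using assms(2) by (simp add: measurable_cong_sets[OF sets_uniform_simplex refl])
  hence "(\<integral>\<^sup>+p. f p \<partial>simplex_lebesgue n)
     = (\<integral>\<^sup>+x. f (chart n x) \<partial>restrict_space (Pi\<^sub>M {1..<n} (\<lambda>_. lborel)) (chart_domain n))"
    unfolding simplex_lebesgue_def by (subst nn_integral_distr[OF measurable_chart[OF assms(1)]]) simp_all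
  also have "\<dots> = (\<integral>\<^sup>+x. f (chart n x) * indicator (chart_domain n) x \<partial>Pi\<^sub>M {1..<n} (\<lambda>_. lborel))"
    by (rule nn_integral_restrict_space) (simp add: chart_domain_eq_corner corner_measurable del: One_nat_def)
  also have "\<dots> = (\<integral>\<^sup>+x. f (chart n x) * indicator (corner 1 n 1) x \<partial>Pi\<^sub>M {1..<n} (\<lambda>_. lborel))"
    by (intro nn_integral_cong) (auto simp: chart_domain_eq_corner indicator_def)
  finally show ?thesis .
qed

lemma measurable_count_below_uniform_simplex [measurable]:
  "(\<lambda>p. count_below 1 n p u) \<in> uniform_simplex n \<rightarrow>\<^sub>M count_space UNIV"
  by (rule measurable_count_below[OF _ measurable_const measurable_uniform_simplex]) auto

lemma nn_integral_count_below_simplex_lebesgue: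
  assumes "n \<ge> 1" "0 \<le> u" "u \<le> 1"
  shows "(\<integral>\<^sup>+p. f (count_below 1 n p u) \<partial>simplex_lebesgue n)
     = (\<Sum>k\<le>n - 1. ennreal (u ^ k / fact k * ((1 - u) ^ (n - 1 - k) / fact (n - 1 - k))) * f k)"
proof -
  have "(\<lambda>p. f (count_below 1 n p u)) \<in> borel_measurable (uniform_simplex n)"
    by (rule measurable_compose[OF measurable_count_below_uniform_simplex]) simp
  from nn_integral_simplex_lebesgue[OF assms(1) this] nn_integral_count_below_corner[OF assms(2,3,1), of f]
  show ?thesis by (simp only: count_below_chart)
qed

text \<open>
  The total mass is the case of the constant function \<open>1\<close> at level \<open>0\<close>, where the sum over \<open>k\<close> has a
  single nonzero term.
\<close>
lemma emeasure_simplex_lebesgue: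
  assumes "n \<ge> 1"
  shows "emeasure (simplex_lebesgue n) (std_simplex n) = ennreal (1 / fact (n - 1))"
proof -
  have "emeasure (simplex_lebesgue n) (std_simplex n) = (\<integral>\<^sup>+p. 1 \<partial>simplex_lebesgue n)"
    using space_uniform_simplex[of n] by (simp add: uniform_simplex_def)
  also have "\<dots> = (\<Sum>k\<le>n - 1. ennreal (0 ^ k / fact k * ((1 - 0) ^ (n - 1 - k) / fact (n - 1 - k))) * 1)"
    using nn_integral_count_below_simplex_lebesgue[OF assms, of 0 "\<lambda>_. 1"] by simp
  also have "\<dots> = (\<Sum>k\<in>{0}. ennreal (0 ^ k / fact k * ((1 - 0) ^ (n - 1 - k) / fact (n - 1 - k))) * 1)"
    by (rule sum.mono_neutral_right) (auto simp: zero_power)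
  finally show ?thesis by simp
qed

lemma prob_space_uniform_simplex:
  assumes "n \<ge> 1"
  shows "prob_space (uniform_simplex n)"
  unfolding uniform_simplex_def
  by (rule prob_space_uniform_measure) (simp_all add: emeasure_simplex_lebesgue[OF assms] del: One_nat_def)

text \<open>
  Normalization multiplies the volumes by \<open>(n - 1)!\<close> and turns the two reciprocal factorials into a
  binomial coefficient: the count follows the binomial distribution.
\<close>
lemma nn_integral_count_below_uniform_simplex:
  assumes "n \<ge> 1" "0 \<le> u" "u \<le> 1"
  shows "(\<integral>\<^sup>+p. f (count_below 1 n p u) \<partial>uniform_simplex n)
     = (\<Sum>k\<le>n - 1. ennreal (Bernstein (n - 1) k u) * f k)"
proof -
  have meas: "(\<lambda>p. f (count_below 1 n p u)) \<in> borel_measurable (simplex_lebesgue n)"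
    using measurable_compose[OF measurable_count_below_uniform_simplex, of f borel n u]
    by (simp add: uniform_simplex_def del: One_nat_def)
  have S: "std_simplex n \<in> sets (simplex_lebesgue n)"
    using sets.top[of "uniform_simplex n"] unfolding space_uniform_simplex by (simp add: uniform_simplex_def)
  have "(\<integral>\<^sup>+p. f (count_below 1 n p u) \<partial>uniform_simplex n)
      = (\<integral>\<^sup>+p. f (count_below 1 n p u) * indicator (std_simplex n) p \<partial>simplex_lebesgue n) / ennreal (1 / fact (n - 1))"
    unfolding uniform_simplex_def using nn_integral_uniform_measure[OF meas S]
    by (simp add: emeasure_simplex_lebesgue[OF assms(1)] del: One_nat_def)
  also have "(\<integral>\<^sup>+p. f (count_below 1 n p u) * indicator (std_simplex n) p \<partial>simplex_lebesgue n)
      = (\<integral>\<^sup>+p. f (count_below 1 n p u) \<partial>simplex_lebesgue n)"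
    using space_uniform_simplex[of n] by (intro nn_integral_cong) (simp add: uniform_simplex_def)
  also have "\<dots> / ennreal (1 / fact (n - 1)) = ennreal (fact (n - 1)) * \<dots>"
    by (simp add: divide_ennreal_def inverse_ennreal mult.commute)
  also have "\<dots> = (\<Sum>k\<le>n - 1. ennreal (Bernstein (n - 1) k u) * f k)"
    unfolding nn_integral_count_below_simplex_lebesgue[OF assms] sum_distrib_left
  proof (intro sum.cong refl)
    fix k assume "k \<in> {..n - 1}"
    hence "fact (n - 1) * (u ^ k / fact k * ((1 - u) ^ (n - 1 - k) / fact (n - 1 - k))) = Bernstein (n - 1) k u"
      by (simp add: Bernstein_def binomial_fact)
    thus "ennreal (fact (n - 1)) * (ennreal (u ^ k / fact k * ((1 - u) ^ (n - 1 - k) / fact (n - 1 - k))) * f k)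
      = ennreal (Bernstein (n - 1) k u) * f k"
      by (simp add: ennreal_mult''[symmetric] mult.assoc[symmetric] assms del: One_nat_def)
  qed
  finally show ?thesis .
qed

lemma mean_gap_nonneg: "0 \<le> t \<Longrightarrow> t \<le> 1 \<Longrightarrow> 0 \<le> mean_gap m t"
  unfolding mean_gap_def by (intro sum_nonneg mult_nonneg_nonneg Bernstein_nonneg) auto

text \<open>
  The counts of two independent uniform weights are independent binomial variables. Since the
  preceding lemma admits an arbitrary function of the count, it applies first to \<open>q\<close> and
  then to \<open>p\<close>.
\<close>
lemma nn_integral_count_below_gap:
  assumes "n \<ge> 1" "0 \<le> u" "u \<le> 1"
  shows "(\<integral>\<^sup>+p. \<integral>\<^sup>+q. ennreal \<bar>real (count_below 1 n p u) - real (count_below 1 n q u)\<bar> \<partial>uniform_simplex n \<partial>uniform_simplex n)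
     = ennreal (mean_gap (n - 1) u)"
proof -
  let ?b = "\<lambda>k. Bernstein (n - 1) k u"
  have b: "0 \<le> ?b k" for k using assms by (simp add: Bernstein_nonneg)
  have "(\<integral>\<^sup>+p. \<integral>\<^sup>+q. ennreal \<bar>real (count_below 1 n p u) - real (count_below 1 n q u)\<bar> \<partial>uniform_simplex n \<partial>uniform_simplex n)
     = (\<integral>\<^sup>+p. (\<Sum>l\<le>n - 1. ennreal (?b l) * ennreal \<bar>real (count_below 1 n p u) - real l\<bar>) \<partial>uniform_simplex n)"
    by (intro nn_integral_cong nn_integral_count_below_uniform_simplex[OF assms])
  also have "\<dots> = (\<Sum>k\<le>n - 1. ennreal (?b k) * (\<Sum>l\<le>n - 1. ennreal (?b l) * ennreal \<bar>real k - real l\<bar>))"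
    by (rule nn_integral_count_below_uniform_simplex[OF assms])
  also have "\<dots> = ennreal (\<Sum>k\<le>n - 1. ?b k * (\<Sum>l\<le>n - 1. ?b l * \<bar>real k - real l\<bar>))"
    by (simp add: b ennreal_mult sum_ennreal[symmetric] sum_nonneg del: One_nat_def)
  finally show ?thesis by (simp add: mean_gap_def sum_distrib_left mult.assoc)
qed

section \<open>The expected distance\<close>

theorem theorem1:
  fixes n :: nat
  assumes "n \<ge> 1"
  shows "prob_space.expectation (Omega n) (X n) =
    2 powi (2 * int n - 3) * (real n - 1) / fact (2 * n - 1) * (fact (n - 1))\<^sup>2"
proof -
  interpret U: prob_space "uniform_simplex n" by (rule prob_space_uniform_simplex[OF assms])
  interpret I: prob_space unit_interval by (rule prob_space_unit_interval)
  interpret P: pair_prob_space "uniform_simplex n" "uniform_simplex n" ..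
  interpret \<Omega>: prob_space "Omega n" unfolding Omega_def by (rule P.prob_space_axioms)
  interpret Q: pair_sigma_finite unit_interval "Omega n" ..
  let ?N = "n - 1"
  let ?gap = "\<lambda>u \<omega>. ennreal \<bar>real (count_below 1 n (fst \<omega>) u) - real (count_below 1 n (snd \<omega>) u)\<bar>"
  define E where "E = 4 ^ ?N / 2 * real ?N * (fact ?N)\<^sup>2 / fact (2 * ?N + 1)"
  have X_eq: "X n \<omega> = cdf_gap n (fst \<omega>) (snd \<omega>)" and X_eq': "ennreal (X n \<omega>) = (\<integral>\<^sup>+u. ?gap u \<omega> \<partial>unit_interval)"
    if "\<omega> \<in> space (Omega n)" for \<omega>
    using that assms
    by (auto simp: X_def Omega_def space_pair_measure space_uniform_simplex wasserstein1_eq_cdf_gap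
        nn_integral_count_below_diff simp del: One_nat_def)
  have comp: "(\<lambda>\<omega>. fst \<omega> i) \<in> borel_measurable (Omega n)" "(\<lambda>\<omega>. snd \<omega> i) \<in> borel_measurable (Omega n)"
    if "i \<in> {1..n}" for i
    unfolding Omega_def
    by (rule measurable_compose[OF measurable_compose[OF measurable_fst measurable_uniform_simplex] measurable_component_singleton[OF that]]
         measurable_compose[OF measurable_compose[OF measurable_snd measurable_uniform_simplex] measurable_component_singleton[OF that]])+
  \<comment> \<open>An infimum over couplings is not visibly measurable, but its closed form is.\<close>
  have X_meas: "X n \<in> borel_measurable (Omega n)"
  proof (subst measurable_cong[OF X_eq])
    show "(\<lambda>\<omega>. cdf_gap n (fst \<omega>) (snd \<omega>)) \<in> borel_measurable (Omega n)"
      unfolding cdf_gap_def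
      by (intro borel_measurable_sum borel_measurable_abs borel_measurable_diff comp) auto
  qed
  have gap_meas: "case_prod ?gap \<in> borel_measurable (unit_interval \<Otimes>\<^sub>M Omega n)"
  proof -
    have subset: "{1..<n} \<subseteq> {1..n}" by auto
    have weights: "(\<lambda>z. fst (snd z)) \<in> unit_interval \<Otimes>\<^sub>M Omega n \<rightarrow>\<^sub>M Pi\<^sub>M {1..n} (\<lambda>_. borel)"
      "(\<lambda>z. snd (snd z)) \<in> unit_interval \<Otimes>\<^sub>M Omega n \<rightarrow>\<^sub>M Pi\<^sub>M {1..n} (\<lambda>_. borel)"
      unfolding Omega_def
      by (rule measurable_compose[OF _ measurable_uniform_simplex], measurable)+
    have level: "(\<lambda>z. fst z) \<in> borel_measurable (unit_interval \<Otimes>\<^sub>M Omega n)"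
      by (rule measurable_compose[OF measurable_fst measurable_unit_interval])
    from borel_measurable_count_below[OF subset level weights(1)] borel_measurable_count_below[OF subset level weights(2)]
    show ?thesis unfolding case_prod_beta
      by (intro measurable_compose[OF _ measurable_ennreal] borel_measurable_abs borel_measurable_diff)
  qed
  have "(\<integral>\<^sup>+\<omega>. ennreal (X n \<omega>) \<partial>Omega n) = (\<integral>\<^sup>+\<omega>. (\<integral>\<^sup>+u. ?gap u \<omega> \<partial>unit_interval) \<partial>Omega n)"
    by (intro nn_integral_cong X_eq')
  also have "\<dots> = (\<integral>\<^sup>+u. (\<integral>\<^sup>+\<omega>. ?gap u \<omega> \<partial>Omega n) \<partial>unit_interval)"
    by (rule Q.Fubini'[OF gap_meas])
  also have "\<dots> = (\<integral>\<^sup>+u. ennreal (mean_gap ?N u) \<partial>unit_interval)"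
  proof (intro nn_integral_cong)
    fix u assume u: "u \<in> space unit_interval"
    have "?gap u \<in> borel_measurable (Omega n)"
      using measurable_Pair_compose_split[OF gap_meas measurable_const[OF u] measurable_ident] by simp
    hence "(\<integral>\<^sup>+\<omega>. ?gap u \<omega> \<partial>Omega n)
       = (\<integral>\<^sup>+p. \<integral>\<^sup>+q. ?gap u (p, q) \<partial>uniform_simplex n \<partial>uniform_simplex n)"
      unfolding Omega_def by (rule U.nn_integral_fst[symmetric])
    also have "\<dots> = ennreal (mean_gap ?N u)"
      using nn_integral_count_below_gap[OF assms, of u] u by simp
    finally show "(\<integral>\<^sup>+\<omega>. ?gap u \<omega> \<partial>Omega n) = ennreal (mean_gap ?N u)" .
  qed
  also have "\<dots> = (\<integral>\<^sup>+u. ennreal (mean_gap ?N u) * indicator {0<..1} u \<partial>lborel)"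
    unfolding unit_interval_def by (rule nn_integral_restrict_space) simp
  also have "\<dots> = (\<integral>\<^sup>+u. ennreal (mean_gap ?N u) * indicator {0..1} u \<partial>lborel)"
    by (rule nn_integral_cong_AE, rule AE_mp[OF AE_lborel_singleton[of 0]]) (auto simp: indicator_def)
  also have "\<dots> = ennreal E"
    unfolding E_def by (rule nn_integral_has_integral_lebesgue'[OF mean_gap_nonneg has_integral_mean_gap]) auto
  finally have "(\<integral>\<^sup>+\<omega>. ennreal (X n \<omega>) \<partial>Omega n) = ennreal E" .
  moreover have "AE \<omega> in Omega n. 0 \<le> X n \<omega>"
    by (rule AE_I2) (simp add: X_eq cdf_gap_def sum_nonneg)
  ultimately have "\<Omega>.expectation (X n) = E"
    using integral_eq_nn_integral[OF X_meas] by (simp add: E_def)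
  also have "E = 2 powi (2 * int n - 3) * (real n - 1) / fact (2 * n - 1) * (fact (n - 1))\<^sup>2"
  proof -
    obtain N where n: "n = Suc N" using assms by (cases n) auto
    have "(2::real) powi (2 * int n - 3) = 2 powi (int (2 * N) - 1)"
      unfolding n by (rule arg_cong[where f = "\<lambda>k. 2 powi k"]) simp
    also have "\<dots> = 2 powi int (2 * N) / 2 powi 1"
      by (rule power_int_diff) simp
    also have "\<dots> = 4 ^ N / 2"
      unfolding power_int_of_nat by (simp add: power_mult)
    finally have e: "(2::real) powi (2 * int n - 3) = 4 ^ N / 2" .
    show ?thesis unfolding E_def e unfolding n by simp
  qed
  finally show ?thesis .
qed

end
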